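(* For every real number $c<\frac12$ there is a set $A\subseteq \mathbb F_2^{\omega}$ with $d^*(A)>c$ such that $A-A$ does not contain a set of the form $B-B+g$, where $B\subseteq\mathbb F_2^\omega$ is piecewise syndetic and $g\in\mathbb F_2^{\omega}$. Consequently, $A-A$ does not contain a Bohr neighborhood of any $g\in\mathbb F_2^{\omega}$.
   Context: $\mathbb F_2^{\omega}=\bigoplus_{n=1}^{\infty}\mathbb F_2$ is the countable direct sum of copies of the two-element field, viewed as a countable abelian group. For subsets of an abelian group $G$ and $t\in G$: $A-A=\{a-b:a,b\in A\}$, $t+A=\{t+a:a\in A\}$. A Følner sequence for a countable abelian group $G$ is a sequence $\mathbf\Phi=(\Phi_n)_{n\in\mathbb N}$ of finite (nonempty) subsets of $G$ with $\lim_{n\to\infty}\frac{|(\Phi_n+g)\cap\Phi_n|}{|\Phi_n|}=1$ for every $g\in G$. The upper Banach density of $A\subseteq G$ is $d^*(A)=\sup_{\mathbf\Phi}\limsup_{n\to\infty}\frac{|A\cap\Phi_n|}{|\Phi_n|}$, the supremum being over all Følner sequences for $G$. A set $B\subseteq G$ is syndetic if $G$ is the union of finitely many translates of $B$. $B\subseteq G$ is piecewise syndetic if there is a syndetic set $B'\subseteq G$ such that for every finite $F\subseteq B'$ there exists $t\in G$ with $t+F\subseteq B$. A Bohr set in $G$ is a set of the form $\{g\in G:|\chi_j(g)-1|<\varepsilon,\ 1\le j\le k\}$, where $\varepsilon>0$ and $\chi_1,\dots,\chi_k:G\to\mathcal S^1=\{z\in\mathbb C:|z|=1\}$ are homomorphisms.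 A Bohr neighborhood of $g\in G$ is a set containing $g+U$ for some Bohr set $U$. *)

theory Defs
  imports "HOL-Library.Poly_Mapping" "HOL-Library.Z2" "HOL-Analysis.Analysis"
begin

text \<open>
  The finitely supported functions from \<^typ>\<open>nat\<close> to the two-element field \<^typ>\<open>bit\<close>, under
  pointwise addition, are the countable direct sum of copies of that field.
\<close>
type_synonym F2_omega = "nat \<Rightarrow>\<^sub>0 bit"

definition translate :: "'a::ab_group_add \<Rightarrow> 'a set \<Rightarrow> 'a set"
  where "translate t A = (\<lambda>a. t + a) ` A"

text \<open>Not \<^term>\<open>A - B\<close>, which is the relative complement of sets.\<close>
definition difference_set :: "'a::ab_group_add set \<Rightarrow> 'a set"
  where "difference_set A = {a - b | a b. a \<in> A \<and> b \<in> A}"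

definition folner_sequence :: "(nat \<Rightarrow> 'a::ab_group_add set) \<Rightarrow> bool"
  where "folner_sequence \<Phi> \<longleftrightarrow>
    (\<forall>n. finite (\<Phi> n) \<and> \<Phi> n \<noteq> {}) \<and>
    (\<forall>g. (\<lambda>n. real (card (translate g (\<Phi> n) \<inter> \<Phi> n)) / real (card (\<Phi> n))) \<longlonglongrightarrow> 1)"

text \<open>
  Valued in the complete lattice \<^typ>\<open>ereal\<close>, so that the limit superior and the supremum
  are meaningful without side conditions.
\<close>
definition upper_banach_density :: "'a::ab_group_add set \<Rightarrow> ereal"
  where "upper_banach_density A =
    (SUP \<Phi>\<in>{\<Phi>. folner_sequence \<Phi>}.
      limsup (\<lambda>n. ereal (real (card (A \<inter> \<Phi> n)) / real (card (\<Phi> n)))))"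

definition syndetic :: "'a::ab_group_add set \<Rightarrow> bool"
  where "syndetic B \<longleftrightarrow> (\<exists>T. finite T \<and> (\<Union>t\<in>T. translate t B) = UNIV)"

definition piecewise_syndetic :: "'a::ab_group_add set \<Rightarrow> bool"
  where "piecewise_syndetic B \<longleftrightarrow>
    (\<exists>B'. syndetic B' \<and> (\<forall>F. finite F \<and> F \<subseteq> B' \<longrightarrow> (\<exists>t. translate t F \<subseteq> B)))"

definition circle_character :: "('a::ab_group_add \<Rightarrow> complex) \<Rightarrow> bool"
  where "circle_character \<psi> \<longleftrightarrow>
    (\<forall>g. norm (\<psi> g) = 1) \<and> (\<forall>g h. \<psi> (g + h) = \<psi> g * \<psi> h)"

text \<open>
  The value \<open>k = 0\<close> is harmless: it yields the whole group, as does the trivial character.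
\<close>
definition bohr_set :: "'a::ab_group_add set \<Rightarrow> bool"
  where "bohr_set U \<longleftrightarrow>
    (\<exists>(\<epsilon>::real) (k::nat) (\<psi> :: nat \<Rightarrow> 'a \<Rightarrow> complex).
      \<epsilon> > 0 \<and> (\<forall>j\<in>{1..k}. circle_character (\<psi> j)) \<and>
      U = {g. \<forall>j\<in>{1..k}. norm (\<psi> j g - 1) < \<epsilon>})"

definition bohr_neighborhood :: "'a::ab_group_add \<Rightarrow> 'a set \<Rightarrow> bool"
  where "bohr_neighborhood g N \<longleftrightarrow> (\<exists>U. bohr_set U \<and> translate g U \<subseteq> N)"

end

theory Submission
  imports Defs
begin

text \<open>
  Vectors are identified with their finite supports. The example combines a set of measure almost
  one half with a colouring theorem of topological origin.

  In the cube of subsets of a set with \<open>n\<close> elements take the sets of size less than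
  \<open>(n - k) / 2\<close>. No two of them differ in \<open>n - k\<close> or more places,
  and for \<open>k\<close> fixed and \<open>n\<close> large they make up almost half of the cube,
  because sizes within \<open>k / 2\<close> of \<open>n / 2\<close> are rare
  (\<open>middle_weights_negligible\<close>). On the other hand, for \<open>k \<le> n\<close>,
  every colouring of the cube with at most \<open>k\<close> colours has two points of the same
  colour that differ in at least \<open>n - k\<close> places
  (\<open>near_antipodal_monochromatic_pair\<close>). That is a form of Lovasz's theorem on Kneser
  graphs; it follows from Tucker's lemma for the octahedral sphere
  (\<open>octahedral_tucker\<close>), which in turn comes from Fan's parity count of alternating
  chains (\<open>fan_parity\<close>). A piecewise syndetic set \<open>B\<close>, up to
  translations, colours all finite cubes with a bounded number \<open>r\<close> of colours, so
  \<open>B - B\<close> meets the vectors of weight at least \<open>n - k\<close> in every block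
  of \<open>n\<close> coordinates as soon as \<open>r \<le> k \<le> n\<close>
  (\<open>piecewise_syndetic_heavy_difference\<close>).

  To defeat every translate \<open>g + (B - B)\<close> for every \<open>r\<close>, it suffices
  that \<open>A - A\<close> misses, for each pair \<open>(g, k)\<close>, all
  \<open>g + t\<close> with \<open>t\<close> of weight at least \<open>n - k\<close> in some
  block of length \<open>n\<close>. Pairs are treated one after the other on disjoint blocks.
  Intersecting cylinder sets would halve the density at every step; instead two copies of the set
  already built are glued together. Over the low points of the new block, of weight less than
  \<open>(n - k) / 2\<close>, it is used unchanged; over the high points, of weight more than
  \<open>(n + k) / 2\<close>, it is translated by \<open>g + e0\<close>, where
  \<open>e0\<close> is a unit vector that is not a difference of the old set. A difference
  \<open>g + t\<close> of two points that are both low or both high on the new block is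
  impossible by weight, and a low and a high point with this difference would yield the forbidden
  difference \<open>e0\<close> in the old set (\<open>glued_avoids_heavy\<close>). Only the points
  of middle weight are lost, so the densities start at one half and decrease by as little as
  desired (\<open>cube_density_ge\<close>).

  The claim on Bohr neighbourhoods follows because the characters of this group take only the
  values \<open>1\<close> and \<open>-1\<close>, so that a Bohr set contains a subgroup of finite
  index (\<open>bohr_set_contains_difference_set\<close>).
\<close>

section \<open>Fan's parity count for alternating labels\<close>

fun alternating :: "bool \<Rightarrow> bool list \<Rightarrow> bool" where
  "alternating s [] = True"
| "alternating s (b # bs) = (b = s \<and> alternating (\<not> s) bs)"

text \<open>
  The coboundary formula behind Fan's lemma: modulo two, the number of ways to reach an alternating
  list by deleting one entry. A list that alternates starting with \<open>s\<close> loses its last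
  entry, one that alternates starting with \<open>\<not> s\<close> loses its first entry, and in
  every other list the admissible deletions come in pairs of neighbouring entries of equal sign.
  The empty list counts as both kinds.
\<close>
lemma sum_alternating_deletions:
  assumes "distinct p"
  shows "(\<Sum>i\<in>set p. of_bool (alternating s (map f (filter (\<lambda>j. j \<noteq> i) p)))) =
    (of_bool (alternating s (map f p)) + of_bool (alternating (\<not> s) (map f p)) :: bit)"
  using assms
proof (induction p arbitrary: s)
  case Nil
  then show ?case by simp
next
  case (Cons a q)
  have "filter (\<lambda>j. j \<noteq> a) q = q"
    using Cons.prems by (intro filter_True) auto
  then have *: "of_bool (alternating s (map f (filter (\<lambda>j. j \<noteq> a) (a # q)))) =
      (of_bool (alternating s (map f q)) :: bit)"
    by simp
  have "(\<Sum>i\<in>set q. of_bool (alternating s (map f (filter (\<lambda>j. j \<noteq> i) (a # q))))) =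
     (\<Sum>i\<in>set q. of_bool (f a = s) * of_bool (alternating (\<not> s) (map f (filter (\<lambda>j. j \<noteq> i) q))) :: bit)"
    using Cons.prems by (intro sum.cong) auto
  also have "\<dots> = of_bool (f a = s) *
      (of_bool (alternating (\<not> s) (map f q)) + of_bool (alternating s (map f q)))"
    using Cons.IH [of "\<not> s"] Cons.prems
    by (simp only: sum_distrib_left [symmetric] distinct.simps not_not simp_thms)
  finally have "(\<Sum>i\<in>set (a # q). of_bool (alternating s (map f (filter (\<lambda>j. j \<noteq> i) (a # q))))) =
      of_bool (alternating s (map f q)) + of_bool (f a = s) *
      (of_bool (alternating (\<not> s) (map f q)) + of_bool (alternating s (map f q)) :: bit)"
    using Cons.prems * by (simp only: list.set(2) sum.insert finite_set distinct.simps simp_thms)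
  then show ?case
    by (cases "f a"; cases s; cases "alternating s (map f q)"; cases "alternating (\<not> s) (map f q)")
      (simp_all del: sum_of_bool_eq)
qed

lemma alternating_map_Not: "alternating s (map Not bs) = alternating (\<not> s) bs"
  by (induction bs arbitrary: s) auto

text \<open>
  The signs are read in the order of increasing absolute value. Equal absolute values need no
  separate treatment: if no two labels are opposite, labels of equal absolute value have equal
  sign, and the alternation excludes them.
\<close>
definition fan_alternating :: "bool \<Rightarrow> int list \<Rightarrow> bool"
  where "fan_alternating s xs \<longleftrightarrow> alternating s (map ((<) 0) (sort_key abs xs))"

lemma sort_key_map: "sort_key f (map g xs) = map g (sort_key (\<lambda>x. f (g x)) xs)"
proof -
  have "insort_key f (g x) (map g ys) = map g (insort_key (\<lambda>x. f (g x)) x ys)" for x ys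
    by (induction ys) auto
  then show ?thesis by (induction xs) auto
qed

lemma sum_fan_alternating_deletions:
  fixes l :: "nat \<Rightarrow> int"
  assumes "distinct p"
  shows "(\<Sum>i\<in>set p. of_bool (fan_alternating s (map l (filter (\<lambda>j. j \<noteq> i) p)))) =
    (of_bool (fan_alternating s (map l p)) + of_bool (fan_alternating (\<not> s) (map l p)) :: bit)"
  using sum_alternating_deletions [of "sort_key (\<lambda>j. \<bar>l j\<bar>) p" s "\<lambda>j. 0 < l j"] assms
  by (simp add: fan_alternating_def sort_key_map filter_sort comp_def del: sum_of_bool_eq)

lemma fan_alternating_uminus:
  assumes "0 \<notin> set xs"
  shows "fan_alternating s (map uminus xs) = fan_alternating (\<not> s) xs"
proof -
  have "map ((<) 0) (map uminus (sort_key abs xs)) = map Not (map ((<) 0) (sort_key abs xs))"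
    using assms by (auto simp: less_le)
  then show ?thesis
    by (simp add: fan_alternating_def sort_key_map alternating_map_Not del: map_map)
qed

lemma sum_fixpoint_free_involution:
  fixes f :: "'a \<Rightarrow> bit"
  assumes "finite X"
    and "\<And>x. x \<in> X \<Longrightarrow> \<phi> x \<in> X" "\<And>x. x \<in> X \<Longrightarrow> \<phi> (\<phi> x) = x"
    and "\<And>x. x \<in> X \<Longrightarrow> \<phi> x \<noteq> x" "\<And>x. x \<in> X \<Longrightarrow> f (\<phi> x) = f x"
  shows "sum f X = 0"
  using assms
proof (induction X rule: finite_psubset_induct)
  case (psubset X)
  show ?case
  proof (cases "X = {}")
    case False
    then obtain x where x: "x \<in> X" by blast
    let ?Y = "X - {x, \<phi> x}"
    have "sum f X = sum f ?Y + sum f {x, \<phi> x}"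
      using psubset.hyps psubset.prems(1) x by (intro sum.subset_diff) auto
    also have "sum f {x, \<phi> x} = f x + f x"
      using psubset.prems(3,4) [OF x] by auto
    also have "\<dots> = 0" by (cases "f x") auto
    also have "sum f ?Y = 0"
    proof (rule psubset.IH)
      show "?Y \<subset> X" using x by blast
      show "\<phi> y \<in> ?Y" if "y \<in> ?Y" for y
        using that psubset.prems(1,2) x by (metis Diff_iff insertE insertI1 insertI2 singletonD)
    qed (use psubset.prems in auto)
    finally show ?thesis by simp
  qed simp
qed

definition flip :: "nat \<times> bool \<Rightarrow> nat \<times> bool"
  where "flip = apsnd Not"

lemma fst_flip [simp]: "fst (flip p) = fst p" and flip_flip [simp]: "flip (flip p) = p"
  by (cases p; simp add: flip_def)+

lemma flip_Pair [simp]: "flip (i, b) = (i, \<not> b)"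
  by (simp add: flip_def)

lemma flip_neq [simp]: "flip p \<noteq> p"
  by (cases p) simp

text \<open>
  A signed permutation \<open>ws\<close> stands for a maximal simplex of the barycentric
  subdivision of the \<open>d\<close>-dimensional octahedron: the vertices are the sets of the
  first \<open>1, 2, \<dots>, d\<close> entries of \<open>ws\<close>, and a pair
  \<open>(i, b)\<close> stands for the unit vector number \<open>i\<close> with sign
  \<open>b\<close>.
\<close>
definition signed_perms :: "nat \<Rightarrow> (nat \<times> bool) list set"
  where "signed_perms d = {ws. distinct (map fst ws) \<and> fst ` set ws = {..<d}}"

definition chain_labels :: "((nat \<times> bool) set \<Rightarrow> int) \<Rightarrow> (nat \<times> bool) list \<Rightarrow> nat \<Rightarrow> int"
  where "chain_labels l ws i = l (set (take (Suc i) ws))"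

lemma signed_permsD:
  assumes "ws \<in> signed_perms d"
  shows "distinct (map fst ws)" "fst ` set ws = {..<d}" "length ws = d"
proof -
  show a: "distinct (map fst ws)" and b: "fst ` set ws = {..<d}"
    using assms by (auto simp: signed_perms_def)
  show "length ws = d"
    using distinct_card [OF a] b by simp
qed

lemma sign_unique:
  fixes S :: "(nat \<times> bool) set"
  assumes "inj_on fst S" "i \<in> fst ` S"
  shows "(i, False) \<in> S \<longleftrightarrow> (i, True) \<notin> S"
proof -
  obtain b where "(i, b) \<in> S" using assms(2) by force
  then show ?thesis
    using inj_onD [OF assms(1), of "(i, True)" "(i, False)"] by (cases b) auto
qed

lemma finite_signed_perms: "finite (signed_perms d)"
proof (rule finite_subset)
  show "signed_perms d \<subseteq> {ws. set ws \<subseteq> {..<d} \<times> UNIV \<and> length ws = d}"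
  proof
    fix ws assume ws: "ws \<in> signed_perms d"
    have "set ws \<subseteq> (fst ` set ws) \<times> UNIV" by force
    then show "ws \<in> {ws. set ws \<subseteq> {..<d} \<times> UNIV \<and> length ws = d}"
      using signed_permsD [OF ws] by auto
  qed
qed (auto intro: finite_lists_length_eq)

text \<open>
  The vertices of the subdivision: nonempty sets of signed indices in which no index occurs with
  both signs, that is, nonzero vectors with entries in \<open>{-1, 0, 1}\<close>.
\<close>
definition signed_set :: "(nat \<times> bool) set \<Rightarrow> bool"
  where "signed_set Z \<longleftrightarrow> finite Z \<and> Z \<noteq> {} \<and> inj_on fst Z"

lemma signed_set_take:
  assumes "ws \<in> signed_perms d" "i < d"
  shows "signed_set (set (take (Suc i) ws))" "fst ` set (take (Suc i) ws) \<subseteq> {..<d}"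
proof -
  note * = signed_permsD [OF assms(1)]
  have "inj_on fst (set ws)" using *(1) by (simp add: distinct_map)
  moreover have sub: "set (take (Suc i) ws) \<subseteq> set ws" by (rule set_take_subset)
  ultimately show "signed_set (set (take (Suc i) ws))"
    using *(3) assms(2) by (auto simp: signed_set_def intro: inj_on_subset)
  show "fst ` set (take (Suc i) ws) \<subseteq> {..<d}" using sub *(2) by blast
qed

text \<open>
  The simplices containing \<open>(d, True)\<close> form a hemisphere. A facet that omits a vertex
  other than the largest one lies in exactly two of them: exchanging the entries \<open>i\<close>
  and \<open>i + 1\<close> of \<open>ws\<close> changes only the set of the first
  \<open>i + 1\<close> entries. These facets therefore cancel.
\<close>
lemma sum_swap_adjacent:
  assumes i: "i < d"
  shows "(\<Sum>ws | ws \<in> signed_perms (Suc d) \<and> (d, True) \<in> set ws.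
           of_bool (fan_alternating s (map (chain_labels l ws) (filter (\<lambda>j. j \<noteq> i) [0..<Suc d])))) = (0 :: bit)"
    (is "sum ?f ?H = 0")
proof (rule sum_fixpoint_free_involution)
  let ?\<phi> = "\<lambda>ws::(nat \<times> bool) list. ws[i := ws ! Suc i, Suc i := ws ! i]"
  show "finite ?H" using finite_signed_perms by simp
  fix ws assume ws: "ws \<in> ?H"
  then have len: "length ws = Suc d" and dist: "distinct (map fst ws)" by (auto dest: signed_permsD)
  then show "?\<phi> (?\<phi> ws) = ws"
    using i by (auto simp: list_eq_iff_nth_eq nth_list_update)
  show "?\<phi> ws \<noteq> ws"
  proof
    assume "?\<phi> ws = ws"
    then have "ws ! i = ws ! Suc i" using i len
      by (metis Suc_less_eq n_not_Suc_n nth_list_update_eq nth_list_update_neq less_SucI)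
    then show False using dist i len
      by (metis Suc_less_eq distinct_map less_SucI n_not_Suc_n nth_eq_iff_index_eq)
  qed
  have "mset (?\<phi> ws) = mset ws"
    using i len by (simp add: mset_swap)
  then have "set (?\<phi> ws) = set ws" "mset (map fst (?\<phi> ws)) = mset (map fst ws)"
    by (metis mset_eq_setD, simp only: mset_map)
  then show "?\<phi> ws \<in> ?H"
    using ws mset_eq_imp_distinct_iff [of "map fst (?\<phi> ws)" "map fst ws"]
    by (simp add: signed_perms_def)
  have "chain_labels l (?\<phi> ws) j = chain_labels l ws j" if "j \<in> set (filter (\<lambda>j. j \<noteq> i) [0..<Suc d])" for j
  proof (cases "j < i")
    case True
    then show ?thesis by (simp add: chain_labels_def)
  next
    case False
    then have "i < j" "j \<le> d" using that by (auto simp del: upt_Suc)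
    then have "mset (take (Suc j) (?\<phi> ws)) = mset (take (Suc j) ws)"
      using len mset_swap [of "Suc i" "take (Suc j) ws" i] by (simp add: take_update_swap)
    then have "set (take (Suc j) (?\<phi> ws)) = set (take (Suc j) ws)" by (rule mset_eq_setD)
    then show ?thesis by (simp only: chain_labels_def)
  qed
  then have "map (chain_labels l (?\<phi> ws)) (filter (\<lambda>j. j \<noteq> i) [0..<Suc d]) =
     map (chain_labels l ws) (filter (\<lambda>j. j \<noteq> i) [0..<Suc d])"
    by (intro map_cong) blast+
  then show "?f (?\<phi> ws) = ?f ws" by (simp only:)
qed

text \<open>
  A facet that omits the largest vertex cancels as well if the index left out is not
  \<open>d\<close>, because the last entry can carry either sign.
\<close>
lemma sum_flip_last:
  "(\<Sum>ws | ws \<in> signed_perms (Suc d) \<and> (d, True) \<in> set ws \<and> fst (last ws) \<noteq> d.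
      of_bool (fan_alternating s (map (chain_labels l ws) [0..<d]))) = (0 :: bit)"
    (is "sum ?f ?H = 0")
proof (rule sum_fixpoint_free_involution)
  let ?\<phi> = "\<lambda>ws. butlast ws @ [flip (last ws)]"
  show "finite ?H" using finite_signed_perms by simp
  fix ws assume ws: "ws \<in> ?H"
  then have len: "length ws = Suc d" and img: "fst ` set ws = {..<Suc d}"
    and dist: "distinct (map fst ws)" by (auto dest: signed_permsD)
  then obtain us w where uw: "ws = us @ [w]" "length us = d"
    by (metis length_Suc_conv_rev)
  show "?\<phi> ws \<in> ?H"
    using ws uw by (auto simp: signed_perms_def)
  show "?\<phi> (?\<phi> ws) = ws" "?\<phi> ws \<noteq> ws"
    using uw by auto
  have "map (chain_labels l (?\<phi> ws)) [0..<d] = map (chain_labels l ws) [0..<d]"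
    using uw by (auto simp: chain_labels_def)
  then show "?f (?\<phi> ws) = ?f ws" by (simp only:)
qed

text \<open>
  What survives of the boundary of the hemisphere are the facets whose missing entry is
  \<open>(d, True)\<close>, and they are the maximal simplices one dimension lower.
\<close>
lemma sum_fan_alternating_Suc:
  "(\<Sum>ws | ws \<in> signed_perms (Suc d) \<and> (d, True) \<in> set ws.
     of_bool (fan_alternating s (map (chain_labels l ws) [0..<Suc d]))
     + of_bool (fan_alternating (\<not> s) (map (chain_labels l ws) [0..<Suc d])) :: bit) =
   (\<Sum>ws\<in>signed_perms d. of_bool (fan_alternating s (map (chain_labels l ws) [0..<d])))"
    (is "?lhs = ?rhs")
proof -
  let ?H = "{ws. ws \<in> signed_perms (Suc d) \<and> (d, True) \<in> set ws}"
  let ?D = "\<lambda>ws i. of_bool (fan_alternating s (map (chain_labels l ws) (filter (\<lambda>j. j \<noteq> i) [0..<Suc d]))) :: bit"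
  let ?f = "\<lambda>ws. of_bool (fan_alternating s (map (chain_labels l ws) [0..<d])) :: bit"
  have fin: "finite ?H" using finite_signed_perms by simp
  have "?lhs = (\<Sum>ws\<in>?H. \<Sum>i\<in>set [0..<Suc d]. ?D ws i)"
    by (simp only: sum_fan_alternating_deletions distinct_upt)
  also have "\<dots> = (\<Sum>i\<in>{..<Suc d}. \<Sum>ws\<in>?H. ?D ws i)"
    by (subst sum.swap) (simp only: set_upt atLeast0LessThan)
  also have "\<dots> = (\<Sum>ws\<in>?H. ?D ws d)"
  proof -
    have "(\<Sum>i\<in>{..<d}. \<Sum>ws\<in>?H. ?D ws i) = 0"
      by (intro sum.neutral ballI sum_swap_adjacent) simp
    then show ?thesis by (simp only: sum.lessThan_Suc add_0)
  qed
  also have "\<dots> = (\<Sum>ws\<in>?H. ?f ws)"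
  proof -
    have "filter (\<lambda>j. j \<noteq> d) [0..<Suc d] = [0..<d]" by (simp add: filter_id_conv)
    then show ?thesis by (simp only:)
  qed
  also have "\<dots> = (\<Sum>ws\<in>{ws \<in> ?H. fst (last ws) \<noteq> d}. ?f ws) + (\<Sum>ws\<in>{ws \<in> ?H. fst (last ws) = d}. ?f ws)"
  proof -
    have "?H = {ws \<in> ?H. fst (last ws) \<noteq> d} \<union> {ws \<in> ?H. fst (last ws) = d}" by blast
    then have "sum ?f ?H = sum ?f ({ws \<in> ?H. fst (last ws) \<noteq> d} \<union> {ws \<in> ?H. fst (last ws) = d})"
      by (rule arg_cong)
    also have "\<dots> = sum ?f {ws \<in> ?H. fst (last ws) \<noteq> d} + sum ?f {ws \<in> ?H. fst (last ws) = d}"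
      by (intro sum.union_disjoint finite_subset [OF _ fin]) blast+
    finally show ?thesis .
  qed
  also have "(\<Sum>ws\<in>{ws \<in> ?H. fst (last ws) \<noteq> d}. ?f ws) = 0"
    using sum_flip_last [of s l d] by (simp only: mem_Collect_eq conj_assoc)
  also have "(\<Sum>ws\<in>{ws \<in> ?H. fst (last ws) = d}. ?f ws) = ?rhs"
  proof (rule sum.reindex_bij_witness [of _ "\<lambda>us. us @ [(d, True)]" butlast])
    fix ws assume "ws \<in> {ws \<in> ?H. fst (last ws) = d}"
    then have ws: "ws \<in> signed_perms (Suc d)" "(d, True) \<in> set ws" "fst (last ws) = d" by auto
    note * = signed_permsD [OF ws(1)]
    obtain us w where uw: "ws = us @ [w]" "length us = d"
      using *(3) by (metis length_Suc_conv_rev)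
    have "d \<notin> fst ` set us" using *(1) ws(3) uw by auto
    then have w: "w = (d, True)" using ws(2) uw by force
    then show "butlast ws @ [(d, True)] = ws" using uw by simp
    show "butlast ws \<in> signed_perms d"
    proof -
      have "insert d (fst ` set us) = insert d {..<d}"
        using *(2) uw w by (simp add: lessThan_Suc)
      then have "fst ` set us = {..<d}"
        using \<open>d \<notin> fst ` set us\<close> by (subst (asm) insert_ident) auto
      then show ?thesis using *(1) uw by (simp add: signed_perms_def)
    qed
    show "?f (butlast ws) = ?f ws"
    proof -
      have "map (chain_labels l (butlast ws)) [0..<d] = map (chain_labels l ws) [0..<d]"
        using uw by (auto simp: chain_labels_def)
      then show ?thesis by (simp only:)
    qed
  next
    fix us assume us: "us \<in> signed_perms d"
    note * = signed_permsD [OF us]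
    show "butlast (us @ [(d, True)]) = us" by simp
    show "us @ [(d, True)] \<in> {ws \<in> ?H. fst (last ws) = d}"
      using * by (auto simp: signed_perms_def lessThan_Suc)
  qed
  finally show ?thesis by simp
qed

text \<open>
  The sphere is the union of the hemisphere and its antipodal image.
\<close>
lemma signed_perms_Suc_split:
  fixes f :: "_ \<Rightarrow> 'b::comm_monoid_add"
  shows "sum f (signed_perms (Suc d)) =
    (\<Sum>ws | ws \<in> signed_perms (Suc d) \<and> (d, True) \<in> set ws. f ws + f (map flip ws))"
proof -
  let ?S = "signed_perms (Suc d)"
  have flip_in: "map flip ws \<in> ?S \<longleftrightarrow> ws \<in> ?S" for ws
    by (simp add: signed_perms_def comp_def image_image)
  have flip_flip: "map flip (map flip ws) = ws" for ws
    by (simp add: comp_def)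
  have mem: "(d, b) \<in> set (map flip ws) \<longleftrightarrow> (d, \<not> b) \<in> set ws" for b ws
    by (cases b) (auto simp: image_iff intro: bexI [of _ "(d, \<not> b)"])
  have ex: "(d, True) \<in> set ws \<longleftrightarrow> (d, False) \<notin> set ws" if "ws \<in> ?S" for ws
  proof -
    have "d \<in> fst ` set ws" "inj_on fst (set ws)"
      using signed_permsD [OF that] by (auto simp: distinct_map)
    then show ?thesis using sign_unique by blast
  qed
  have "sum f ?S = sum f {ws \<in> ?S. (d, True) \<in> set ws} + sum f {ws \<in> ?S. (d, True) \<notin> set ws}"
    by (subst sum.union_disjoint [symmetric])
      (auto intro: sum.cong simp: finite_signed_perms)
  also have "sum f {ws \<in> ?S. (d, True) \<notin> set ws} = (\<Sum>ws | ws \<in> ?S \<and> (d, True) \<in> set ws. f (map flip ws))"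
    by (rule sum.reindex_bij_witness [of _ "map flip" "map flip"])
      (auto simp only: mem_Collect_eq flip_in flip_flip mem ex not_True_eq_False)
  finally show ?thesis
    by (simp add: sum.distrib)
qed

text \<open>
  Under an antipodal labelling the antipode of a simplex that alternates starting with a negative
  sign alternates starting with a positive one. Hence counting positively alternating simplices
  over the sphere is the same as counting alternating simplices of either sign over a hemisphere,
  and the coboundary formula moves this count to the sphere one dimension lower.
\<close>
lemma fan_parity:
  assumes anti: "\<And>Z. signed_set Z \<Longrightarrow> fst ` Z \<subseteq> {..<n} \<Longrightarrow> l (flip ` Z) = - l Z \<and> l Z \<noteq> 0"
    and "d \<le> n"
  shows "(\<Sum>ws\<in>signed_perms d. of_bool (fan_alternating True (map (chain_labels l ws) [0..<d]))) = (1 :: bit)"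
  using \<open>d \<le> n\<close>
proof (induction d)
  case 0
  have "signed_perms 0 = {[]}" by (auto simp: signed_perms_def)
  then show ?case by (simp add: fan_alternating_def)
next
  case (Suc d)
  let ?f = "\<lambda>s ws. of_bool (fan_alternating s (map (chain_labels l ws) [0..<Suc d])) :: bit"
  have "?f True (map flip ws) = ?f (\<not> True) ws" if ws: "ws \<in> signed_perms (Suc d)" for ws
  proof -
    have lab: "chain_labels l (map flip ws) i = - chain_labels l ws i \<and> chain_labels l ws i \<noteq> 0"
      if "i < Suc d" for i
    proof -
      have "fst ` set (take (Suc i) ws) \<subseteq> {..<n}"
        using signed_set_take(2) [OF ws that] Suc.prems by auto
      then show ?thesis
        using anti [OF signed_set_take(1) [OF ws that]] by (simp add: chain_labels_def take_map)
    qed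
    then have "map (chain_labels l (map flip ws)) [0..<Suc d] = map uminus (map (chain_labels l ws) [0..<Suc d])"
      by auto
    moreover have "0 \<notin> set (map (chain_labels l ws) [0..<Suc d])"
      using lab by (auto simp: image_iff simp del: upt_Suc)
    ultimately show ?thesis by (simp only: fan_alternating_uminus simp_thms)
  qed
  then have "sum (?f True) (signed_perms (Suc d)) =
    (\<Sum>ws | ws \<in> signed_perms (Suc d) \<and> (d, True) \<in> set ws. ?f True ws + ?f (\<not> True) ws)"
    unfolding signed_perms_Suc_split by (intro sum.cong) auto
  also have "\<dots> = 1"
    using Suc.IH Suc.prems by (simp only: sum_fan_alternating_Suc Suc_leD)
  finally show ?case .
qed

lemma alternating_nth:
  "alternating s bs \<Longrightarrow> Suc i < length bs \<Longrightarrow> bs ! Suc i = (\<not> bs ! i)"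
proof (induction bs arbitrary: s i)
  case (Cons b bs)
  then show ?case by (cases i; cases bs) auto
qed simp

lemma fan_alternating_distinct:
  assumes fan: "fan_alternating s xs"
    and compl: "\<And>a b. a \<in> set xs \<Longrightarrow> b \<in> set xs \<Longrightarrow> a \<noteq> - b"
  shows "distinct (map abs xs)"
proof -
  let ?ys = "sort_key abs xs"
  have "sorted_wrt (<) (map abs ?ys)"
    unfolding sorted_wrt_iff_nth_Suc_transp [OF transp_on_less]
  proof (intro allI impI)
    fix i assume i: "Suc i < length (map abs ?ys)"
    have mem: "?ys ! i \<in> set xs" "?ys ! Suc i \<in> set xs"
      using i by (metis Suc_lessD length_map nth_mem set_sort, metis length_map nth_mem set_sort)
    have "sorted (map abs ?ys)" by simp
    then have "map abs ?ys ! i \<le> map abs ?ys ! Suc i"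
      using i by (intro sorted_nth_mono) auto
    moreover have "(0 < ?ys ! Suc i) = (\<not> 0 < ?ys ! i)"
      using alternating_nth [OF fan [unfolded fan_alternating_def], of i] i by simp
    moreover have "?ys ! i \<noteq> - ?ys ! Suc i" "?ys ! i \<noteq> 0" "?ys ! Suc i \<noteq> 0"
      using compl [OF mem] compl [OF mem(1) mem(1)] compl [OF mem(2) mem(2)] by auto
    ultimately show "map abs ?ys ! i < map abs ?ys ! Suc i"
      using i by auto
  qed
  then have "distinct (map abs ?ys)" by (simp add: strict_sorted_iff)
  then show ?thesis by (metis distinct_map distinct_sort set_sort)
qed

text \<open>
  An alternating chain without opposite labels has labels of \<open>n\<close> distinct absolute
  values, which is too many for labels of absolute value less than \<open>n\<close>. By parity an
  alternating chain exists, so opposite labels occur on it.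
\<close>
lemma octahedral_tucker:
  fixes l :: "(nat \<times> bool) set \<Rightarrow> int"
  assumes anti: "\<And>Z. signed_set Z \<Longrightarrow> fst ` Z \<subseteq> {..<n} \<Longrightarrow> l (flip ` Z) = - l Z \<and> l Z \<noteq> 0"
    and bound: "\<And>Z. signed_set Z \<Longrightarrow> fst ` Z \<subseteq> {..<n} \<Longrightarrow> \<bar>l Z\<bar> < int n"
    and "n > 0"
  obtains Z Z' where "signed_set Z" "signed_set Z'" "Z \<subseteq> Z'" "fst ` Z' \<subseteq> {..<n}" "l Z = - l Z'"
proof -
  have "\<exists>ws\<in>signed_perms n. fan_alternating True (map (chain_labels l ws) [0..<n])"
  proof (rule ccontr)
    assume "\<not> ?thesis"
    then have "(\<Sum>ws\<in>signed_perms n. of_bool (fan_alternating True (map (chain_labels l ws) [0..<n]))) = (0 :: bit)"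
      by (intro sum.neutral) auto
    then show False using fan_parity [of n l n, OF anti] by simp
  qed
  then obtain ws where ws: "ws \<in> signed_perms n"
    and fan: "fan_alternating True (map (chain_labels l ws) [0..<n])" by blast
  let ?ls = "map (chain_labels l ws) [0..<n]"
  note set_take = signed_set_take [OF ws]
  have "\<not> distinct (map abs ?ls)"
  proof
    assume "distinct (map abs ?ls)"
    then have "card (set (map abs ?ls)) = n" by (simp only: distinct_card length_map length_upt)
    moreover have "set (map abs ?ls) \<subseteq> {1..<int n}"
    proof
      fix x assume "x \<in> set (map abs ?ls)"
      then obtain i where i: "i < n" "x = \<bar>chain_labels l ws i\<bar>" by auto
      then show "x \<in> {1..<int n}"
        using anti [OF set_take [OF i(1)]] bound [OF set_take [OF i(1)]]
        by (auto simp: chain_labels_def)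
    qed
    then have "card (set (map abs ?ls)) \<le> card {1..<int n}" by (intro card_mono) auto
    ultimately show False using \<open>n > 0\<close> by simp
  qed
  then obtain i j where ij: "i < n" "j < n" "chain_labels l ws i = - chain_labels l ws j"
    using fan_alternating_distinct [OF fan] by (fastforce simp del: map_map)
  have "\<exists>i j. i \<le> j \<and> j < n \<and> chain_labels l ws i = - chain_labels l ws j"
  proof (cases "i \<le> j")
    case False
    then show ?thesis using ij by (intro exI [of _ j] exI [of _ i]) auto
  qed (use ij in blast)
  then obtain i j where ij: "i \<le> j" "j < n" "chain_labels l ws i = - chain_labels l ws j" by blast
  show thesis
  proof (rule that)
    show "signed_set (set (take (Suc i) ws))" "signed_set (set (take (Suc j) ws))"
      "fst ` set (take (Suc j) ws) \<subseteq> {..<n}"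
      using ij set_take by auto
    show "set (take (Suc i) ws) \<subseteq> set (take (Suc j) ws)"
      using ij by (intro set_take_subset_set_take) simp
    show "l (set (take (Suc i) ws)) = - l (set (take (Suc j) ws))"
      using ij by (simp add: chain_labels_def)
  qed
qed

section \<open>Colourings of the cube\<close>
definition leading_sign :: "(nat \<times> bool) set \<Rightarrow> bool"
  where "leading_sign Z \<longleftrightarrow> (Min (fst ` Z), True) \<in> Z"

text \<open>
  A vector with entries in \<open>{-1, 0, 1}\<close> is turned into a point of the cube by
  filling its zeros with its first nonzero sign. The choice of filling commutes with the change of
  all signs.
\<close>
definition completion :: "nat \<Rightarrow> (nat \<times> bool) set \<Rightarrow> nat set"
  where "completion n Z = {i. i < n \<and> ((i, True) \<in> Z \<or> i \<notin> fst ` Z \<and> leading_sign Z)}"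

lemma fst_image_flip [simp]: "fst ` (flip ` Z) = fst ` Z"
  by (simp add: image_image)

lemma in_flip_image: "(i, b) \<in> flip ` Z \<longleftrightarrow> (i, \<not> b) \<in> Z"
proof
  assume "(i, b) \<in> flip ` Z"
  then obtain p where "p \<in> Z" "(i, b) = flip p" by blast
  then have "flip (i, b) \<in> Z" by simp
  then show "(i, \<not> b) \<in> Z" by simp
next
  assume "(i, \<not> b) \<in> Z"
  then have "flip (i, \<not> b) \<in> flip ` Z" by (rule imageI)
  then show "(i, b) \<in> flip ` Z" by simp
qed

lemma signed_set_unique:
  assumes "signed_set Z" "i \<in> fst ` Z"
  shows "(i, False) \<in> Z \<longleftrightarrow> (i, True) \<notin> Z"
  using assms by (simp add: signed_set_def sign_unique)

lemma leading_sign_flip: "signed_set Z \<Longrightarrow> leading_sign (flip ` Z) = (\<not> leading_sign Z)"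
proof -
  assume Z: "signed_set Z"
  then have "Min (fst ` Z) \<in> fst ` Z" by (intro Min_in) (auto simp: signed_set_def)
  then show ?thesis
    using signed_set_unique [OF Z] by (simp add: leading_sign_def in_flip_image)
qed

lemma completion_flip:
  assumes "signed_set Z"
  shows "completion n (flip ` Z) = {..<n} - completion n Z"
proof -
  have "i \<in> completion n (flip ` Z) \<longleftrightarrow> i \<in> {..<n} - completion n Z" for i
  proof (cases "i \<in> fst ` Z")
    case True
    then show ?thesis
      using signed_set_unique [OF assms True] by (auto simp: completion_def in_flip_image)
  next
    case False
    then have "(i, True) \<notin> Z" "(i, False) \<notin> Z" by force+
    then show ?thesis
      using False by (auto simp: completion_def in_flip_image leading_sign_flip [OF assms])
  qed
  then show ?thesis by blast
qed

text \<open>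
  Suppose that points of the same colour never differ in \<open>n - k\<close> or more places.
  Label a signed set with at most \<open>n - k\<close> elements by its size, with its leading
  sign. Label a larger one by \<open>n - k + 1\<close> plus the smaller of the colours of its
  completion and of the complement of that completion, with a sign telling which of the two is
  smaller; they differ since the two points are complementary. This labelling is antipodal, and its
  absolute values stay below \<open>n\<close> because the smaller of two distinct colours is at
  most \<open>r - 2\<close>. Tucker's lemma yields comparable sets
  \<open>Z \<subseteq> Z'\<close> with opposite labels. Both are large, since nested small sets
  with labels of equal absolute value coincide. Hence the completion of \<open>Z\<close> and the
  complement of the completion of \<open>Z'\<close> have the same colour, yet they differ at all of
  the more than \<open>n - k\<close> places of \<open>Z\<close>.
\<close>
lemma near_antipodal_monochromatic_pair:
  fixes c :: "nat set \<Rightarrow> nat"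
  assumes colours: "\<And>X. X \<subseteq> {..<n} \<Longrightarrow> c X < r"
    and "r \<le> k" "k \<le> n" "n > 0"
  obtains X Y where "X \<subseteq> {..<n}" "Y \<subseteq> {..<n}" "c X = c Y" "n - k \<le> card ((X - Y) \<union> (Y - X))"
proof (rule ccontr)
  assume "\<not> thesis"
  with that have no: False if "X \<subseteq> {..<n}" "Y \<subseteq> {..<n}" "c X = c Y" "n - k \<le> card ((X - Y) \<union> (Y - X))" for X Y
    using that by blast
  let ?f = "completion n"
  have sub: "?f Z \<subseteq> {..<n}" for Z by (auto simp: completion_def)
  define a where "a Z = c (?f Z)" for Z
  define l where "l Z = (if card Z \<le> n - k then (if leading_sign Z then int (card Z) else - int (card Z))
     else if a Z < a (flip ` Z) then int (n - k + 1 + a Z) else - int (n - k + 1 + a (flip ` Z)))" for Z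
  have card_flip: "card (flip ` Z) = card Z" for Z
    by (intro card_image inj_on_inverseI [of _ flip]) simp
  have flip_flip_image: "flip ` flip ` Z = Z" for Z by (simp add: image_image)
  have a_neq: "a Z \<noteq> a (flip ` Z)" if "signed_set Z" for Z
  proof
    assume "a Z = a (flip ` Z)"
    moreover have "(?f Z - ?f (flip ` Z)) \<union> (?f (flip ` Z) - ?f Z) = {..<n}"
      using sub [of Z] completion_flip [OF that] by auto
    ultimately show False using no [of "?f Z" "?f (flip ` Z)"] sub by (simp add: a_def)
  qed
  have a_less: "a Z < r" for Z using colours sub by (simp add: a_def)
  have pos: "card Z > 0" if "signed_set Z" for Z
    using that by (auto simp: signed_set_def card_gt_0_iff)
  have anti: "l (flip ` Z) = - l Z \<and> l Z \<noteq> 0" if Z: "signed_set Z" for Z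
    using leading_sign_flip [OF Z] a_neq [OF Z] pos [OF Z] by (auto simp: l_def card_flip flip_flip_image)
  have bound: "\<bar>l Z\<bar> < int n" if Z: "signed_set Z" for Z
  proof -
    have "n - k + 1 + min (a Z) (a (flip ` Z)) < n" 
      using a_neq [OF Z] a_less [of Z] a_less [of "flip ` Z"] \<open>r \<le> k\<close> \<open>k \<le> n\<close> by linarith
    moreover have "n - k < n" using a_less [of Z] \<open>r \<le> k\<close> \<open>k \<le> n\<close> by linarith
    ultimately show ?thesis by (auto simp: l_def min_def split: if_splits)
  qed
  obtain Z0 Z0' where Z0: "signed_set Z0" "signed_set Z0'" "Z0 \<subseteq> Z0'" "fst ` Z0' \<subseteq> {..<n}" "l Z0 = - l Z0'"
    by (rule octahedral_tucker [of n l]) (use anti bound \<open>n > 0\<close> in auto)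
  \<comment> \<open>Replacing both sets by their antipodes makes the label of the smaller one positive.\<close>
  have signed_flip: "signed_set (flip ` Z)" if "signed_set Z" for Z
    using that by (auto simp: signed_set_def inj_on_def)
  have "\<exists>Z Z'. signed_set Z \<and> signed_set Z' \<and> Z \<subseteq> Z' \<and> fst ` Z' \<subseteq> {..<n} \<and> l Z = - l Z' \<and> 0 < l Z"
  proof (cases "0 < l Z0")
    case False
    then have "0 < l (flip ` Z0)" "l (flip ` Z0) = - l (flip ` Z0')"
      using anti [OF Z0(1)] anti [OF Z0(2)] Z0(5) by auto
    then show ?thesis
      using Z0 signed_flip by (intro exI [of _ "flip ` Z0"] exI [of _ "flip ` Z0'"]) auto
  qed (use Z0 in blast)
  then obtain Z Z' where Z: "signed_set Z" "signed_set Z'" "Z \<subseteq> Z'" "fst ` Z' \<subseteq> {..<n}"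
    "l Z = - l Z'" "0 < l Z" by blast
  have fin: "finite Z'" using Z(2) by (simp add: signed_set_def)
  have large: "n - k < card Z"
  proof (rule ccontr)
    assume small: "\<not> n - k < card Z"
    have "\<bar>l Z'\<bar> = int (card Z)" using small Z(5) by (auto simp: l_def split: if_splits)
    then have "card Z' = card Z" using small by (auto simp: l_def split: if_splits)
    then have "Z = Z'" using Z(3) fin by (simp add: card_subset_eq)
    then show False using Z(5) anti [OF Z(1)] by simp
  qed
  then have large': "n - k < card Z'" using card_mono [OF fin Z(3)] by linarith
  have "a Z = a (flip ` Z')"
    using Z(5,6) large large' by (auto simp: l_def split: if_splits)
  moreover have "n - k \<le> card ((?f Z - ?f (flip ` Z')) \<union> (?f (flip ` Z') - ?f Z))"
  proof -
    have "fst ` Z \<subseteq> (?f Z - ?f (flip ` Z')) \<union> (?f (flip ` Z') - ?f Z)"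
    proof
      fix i assume i: "i \<in> fst ` Z"
      then have i': "i \<in> fst ` Z'" "i < n" using Z(3,4) by auto
      have "i \<in> ?f Z \<longleftrightarrow> (i, True) \<in> Z"
        using i i' by (simp add: completion_def)
      moreover have "i \<in> ?f (flip ` Z') \<longleftrightarrow> (i, True) \<notin> Z'"
        using i' signed_set_unique [OF Z(2) i'(1)] by (simp add: completion_def in_flip_image)
      moreover have "(i, True) \<in> Z \<longleftrightarrow> (i, True) \<in> Z'"
        using signed_set_unique [OF Z(1) i] signed_set_unique [OF Z(2) i'(1)] Z(3) by blast
      ultimately show "i \<in> (?f Z - ?f (flip ` Z')) \<union> (?f (flip ` Z') - ?f Z)" by blast
    qed
    moreover have "card (fst ` Z) = card Z"
      using Z(1) by (simp add: signed_set_def card_image)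
    moreover have "finite ((?f Z - ?f (flip ` Z')) \<union> (?f (flip ` Z') - ?f Z))"
      using sub by (meson finite_Diff finite_UnI finite_lessThan finite_subset)
    ultimately show ?thesis using large by (metis card_mono le_trans less_imp_le)
  qed
  ultimately show False using no [of "?f Z" "?f (flip ` Z')"] sub by (simp add: a_def)
qed

section \<open>Weights near one half are negligible\<close>

text \<open>
  The sharp order of magnitude up to a constant: the quotient of consecutive central binomial
  coefficients is \<open>2 (2 m + 1) / (m + 1)\<close>, and
  \<open>(2 m + 1) (2 m + 3) \<le> (2 m + 2)\<^sup>2\<close>.
\<close>
lemma central_binomial_upper_bound:
  "real ((2 * m) choose m) * sqrt (2 * real m + 1) \<le> 4 ^ m"
proof (induction m)
  case (Suc m)
  let ?c = "real ((2 * m) choose m)" and ?m = "real m"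
  have rec: "(?m + 1) * real ((2 * Suc m) choose Suc m) = 2 * (2 * ?m + 1) * ?c"
  proof -
    have "Suc m * ((2 * Suc m) choose Suc m) = (2 * Suc m) * (Suc (2 * m) choose m)"
      using Suc_times_binomial_eq [of "Suc (2 * m)" m] by simp
    moreover have "Suc m * (Suc (2 * m) choose m) = Suc (2 * m) * ((2 * m) choose m)"
      using Suc_times_binomial_add [of m m] binomial_absorb_comp [of "Suc (2 * m)" m] by simp
    ultimately have "Suc m * (Suc m * ((2 * Suc m) choose Suc m)) = Suc m * (2 * (Suc (2 * m) * ((2 * m) choose m)))"
      by algebra
    then have "Suc m * ((2 * Suc m) choose Suc m) = 2 * (Suc (2 * m) * ((2 * m) choose m))"
      by (simp only: mult_cancel1) simp
    then have "real (Suc m * ((2 * Suc m) choose Suc m)) = real (2 * (Suc (2 * m) * ((2 * m) choose m)))"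
      by (rule arg_cong)
    then show ?thesis by (simp add: algebra_simps)
  qed
  have "sqrt (2 * ?m + 1) * sqrt (2 * ?m + 3) \<le> 2 * (?m + 1)"
    unfolding real_sqrt_mult [symmetric]
    by (rule real_le_lsqrt) (auto simp: power2_eq_square algebra_simps)
  then have "sqrt (2 * ?m + 1) * (sqrt (2 * ?m + 1) * sqrt (2 * ?m + 3)) \<le> sqrt (2 * ?m + 1) * (2 * (?m + 1))"
    by (intro mult_left_mono) auto
  then have "(2 * ?m + 1) * sqrt (2 * ?m + 3) \<le> 2 * (?m + 1) * sqrt (2 * ?m + 1)"
    by (simp add: mult.assoc [symmetric] mult.commute)
  then have "2 * ?c * ((2 * ?m + 1) * sqrt (2 * ?m + 3)) \<le> 2 * ?c * (2 * (?m + 1) * sqrt (2 * ?m + 1))"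
    by (intro mult_left_mono) auto
  also have "\<dots> = 4 * (?m + 1) * (?c * sqrt (2 * ?m + 1))" by (simp add: algebra_simps)
  also have "\<dots> \<le> 4 * (?m + 1) * 4 ^ m"
    using Suc.IH by (intro mult_left_mono) (auto simp: add.commute)
  also have "2 * ?c * ((2 * ?m + 1) * sqrt (2 * ?m + 3)) = (2 * (2 * ?m + 1) * ?c) * sqrt (2 * ?m + 3)"
    by (simp only: mult_ac)
  also have "\<dots> = (?m + 1) * (real ((2 * Suc m) choose Suc m) * sqrt (2 * ?m + 3))"
    by (subst rec [symmetric]) (simp only: mult.assoc)
  also have "4 * (?m + 1) * 4 ^ m = (?m + 1) * 4 ^ Suc m"
    by simp
  finally have "real ((2 * Suc m) choose Suc m) * sqrt (2 * ?m + 3) \<le> 4 ^ Suc m"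
    by (rule mult_left_le_imp_le) simp
  moreover have "2 * real (Suc m) + 1 = 2 * ?m + 3" by simp
  ultimately show ?case by (simp only:)
qed simp

definition middle_weights :: "nat \<Rightarrow> nat \<Rightarrow> nat set"
  where "middle_weights n k = {w. n \<le> 2 * w + k \<and> 2 * w \<le> n + k}"

lemma sum_middle_binomials_le:
  "real (\<Sum>w\<in>middle_weights (2 * m) k. (2 * m) choose w) \<le> (2 * k + 1) * 4 ^ m / sqrt (2 * real m + 1)"
proof -
  have sub: "middle_weights (2 * m) k \<subseteq> {m - k..m + k}" by (auto simp: middle_weights_def)
  have "(\<Sum>w\<in>middle_weights (2 * m) k. (2 * m) choose w) \<le> card (middle_weights (2 * m) k) * ((2 * m) choose m)"
    using sum_bounded_above [of "middle_weights (2 * m) k" "\<lambda>w. (2 * m) choose w" "(2 * m) choose m"]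
    binomial_maximum' [of m] by auto
  also have "card (middle_weights (2 * m) k) \<le> card {m - k..m + k}"
    using sub by (intro card_mono) auto
  also have "card {m - k..m + k} \<le> 2 * k + 1" by simp
  finally have "real (\<Sum>w\<in>middle_weights (2 * m) k. (2 * m) choose w) \<le> real ((2 * k + 1) * ((2 * m) choose m))"
    by (simp only: of_nat_le_iff) simp
  also have "\<dots> \<le> (2 * k + 1) * 4 ^ m / sqrt (2 * real m + 1)"
  proof -
    have "real ((2 * m) choose m) \<le> 4 ^ m / sqrt (2 * real m + 1)"
      using central_binomial_upper_bound [of m] by (subst pos_le_divide_eq) auto
    then have "(2 * real k + 1) * real ((2 * m) choose m) \<le> (2 * real k + 1) * (4 ^ m / sqrt (2 * real m + 1))"
      by (intro mult_left_mono) auto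
    then show ?thesis
      by (simp only: times_divide_eq_right of_nat_mult of_nat_add of_nat_numeral of_nat_1 of_nat_power)
  qed
  finally show ?thesis by (simp only: of_nat_mult of_nat_add of_nat_numeral of_nat_1 of_nat_power)
qed

lemma middle_weights_negligible:
  assumes "\<epsilon> > 0"
  obtains n where "k < n" "real (\<Sum>w\<in>middle_weights n k. n choose w) \<le> \<epsilon> * 2 ^ n"
proof -
  \<comment> \<open>The summand \<open>real k + 1\<close> gives \<open>k < 2 * m\<close>; the square makes the bound of the previous lemma at most \<open>\<epsilon> * 4 ^ m\<close>.\<close>
  obtain m :: nat where m: "real m \<ge> ((2 * real k + 1) / \<epsilon>)\<^sup>2 + real k + 1"
    using real_arch_simple by blast
  have "0 \<le> ((2 * real k + 1) / \<epsilon>)\<^sup>2" by simp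
  then have "real k < 2 * real m" using m by linarith
  then have "k < 2 * m" by linarith
  have "(2 * real k + 1) / \<epsilon> \<le> sqrt (2 * real m + 1)"
  proof (rule real_le_rsqrt)
    show "((2 * real k + 1) / \<epsilon>)\<^sup>2 \<le> 2 * real m + 1" using m by linarith
  qed
  then have "2 * real k + 1 \<le> \<epsilon> * sqrt (2 * real m + 1)"
    using assms by (simp only: pos_divide_le_eq mult.commute)
  then have "(2 * real k + 1) * 4 ^ m / sqrt (2 * real m + 1) \<le> (\<epsilon> * sqrt (2 * real m + 1)) * 4 ^ m / sqrt (2 * real m + 1)"
    by (intro divide_right_mono mult_right_mono) auto
  also have "\<dots> = \<epsilon> * 4 ^ m" by simp
  finally have "real (\<Sum>w\<in>middle_weights (2 * m) k. (2 * m) choose w) \<le> \<epsilon> * 4 ^ m"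
    by (rule order_trans [OF sum_middle_binomials_le])
  also have "(4::real) ^ m = 2 ^ (2 * m)" by (simp add: power_mult)
  finally have "real (\<Sum>w\<in>middle_weights (2 * m) k. (2 * m) choose w) \<le> \<epsilon> * 2 ^ (2 * m)" .
  with \<open>k < 2 * m\<close> show thesis by (rule that)
qed

section \<open>Vectors over the two-element field as finite sets\<close>

abbreviation support :: "F2_omega \<Rightarrow> nat set"
  where "support \<equiv> Poly_Mapping.keys"

lemma bit_add_self: "(b :: bit) + b = 0"
  by (cases b) auto

lemma add_self [simp]: "(x :: F2_omega) + x = 0"
  by (rule poly_mapping_eqI) (simp only: lookup_add bit_add_self lookup_zero)

lemma diff_eq_add: "(x :: F2_omega) - y = x + y"
  by (rule poly_mapping_eqI) (simp only: lookup_minus lookup_add minus_bit_def)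

lemma keys_plus: "support (x + y :: F2_omega) = (support x - support y) \<union> (support y - support x)"
proof (rule set_eqI)
  fix i
  show "i \<in> support (x + y) \<longleftrightarrow> i \<in> (support x - support y) \<union> (support y - support x)"
    unfolding Diff_iff Un_iff in_keys_iff lookup_add
    by (cases "Poly_Mapping.lookup x i"; cases "Poly_Mapping.lookup y i") simp_all
qed

lift_definition indicator_vector :: "nat set \<Rightarrow> F2_omega"
  is "\<lambda>X i. if finite X then of_bool (i \<in> X) else 0"
  by (auto elim!: rev_finite_subset)

lemma keys_indicator_vector [simp]: "finite X \<Longrightarrow> support (indicator_vector X) = X"
  by transfer auto

lemma eq_iff_keys_eq: "(x :: F2_omega) = y \<longleftrightarrow> support x = support y"
proof
  assume "support x = support y"
  show "x = y"
  proof (rule poly_mapping_eqI)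
    fix i
    have "(Poly_Mapping.lookup x i \<noteq> 0) = (Poly_Mapping.lookup y i \<noteq> 0)"
      using \<open>support x = support y\<close> by (metis in_keys_iff)
    then show "Poly_Mapping.lookup x i = Poly_Mapping.lookup y i" by (cases "Poly_Mapping.lookup x i"; cases "Poly_Mapping.lookup y i") auto
  qed
qed simp

lemma indicator_vector_keys [simp]: "indicator_vector (support x) = x"
  by (simp add: eq_iff_keys_eq)

definition supported_on :: "nat set \<Rightarrow> F2_omega set"
  where "supported_on I = {x. support x \<subseteq> I}"

lemma bij_betw_supported_on:
  assumes "finite I"
  shows "bij_betw support (supported_on I) (Pow I)"
proof (rule bij_betw_byWitness [where f' = indicator_vector])
  have "finite X" if "X \<in> Pow I" for X
    using that assms finite_subset by blast
  then show "\<forall>X\<in>Pow I. support (indicator_vector X) = X"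
    and "indicator_vector ` Pow I \<subseteq> supported_on I"
    by (auto simp: supported_on_def)
qed (auto simp: supported_on_def)

lemma finite_supported_on: "finite I \<Longrightarrow> finite (supported_on I)"
  using bij_betw_supported_on bij_betw_finite by blast

lemma card_supported_on: "finite I \<Longrightarrow> card (supported_on I) = 2 ^ card I"
  using bij_betw_same_card [OF bij_betw_supported_on] by (simp add: card_Pow)

lemma card_supported_on_weight:
  assumes "finite I"
  shows "card {x \<in> supported_on I. card (support x) \<in> W} = (\<Sum>w\<in>W \<inter> {..card I}. card I choose w)"
proof -
  have "bij_betw support {x \<in> supported_on I. card (support x) \<in> W} {X \<in> Pow I. card X \<in> W}"
    using bij_betw_supported_on [OF assms] by (rule bij_betw_Collect) (auto simp: supported_on_def)
  then have "card {x \<in> supported_on I. card (support x) \<in> W} = card {X \<in> Pow I. card X \<in> W}"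
    by (rule bij_betw_same_card)
  also have "{X \<in> Pow I. card X \<in> W} = (\<Union>w\<in>W \<inter> {..card I}. {X. X \<subseteq> I \<and> card X = w})"
    using assms by (auto intro: card_mono)
  also have "card \<dots> = (\<Sum>w\<in>W \<inter> {..card I}. card {X. X \<subseteq> I \<and> card X = w})"
    using assms by (intro card_UN_disjoint) (auto intro: finite_subset [of _ "Pow I"])
  also have "\<dots> = (\<Sum>w\<in>W \<inter> {..card I}. card I choose w)"
    using assms by (intro sum.cong) (auto simp: n_subsets)
  finally show ?thesis .
qed

section \<open>Iterated gluing\<close>
lemma support_plus_subset: "support (x + y) \<subseteq> support x \<union> support y"
  by (auto simp: keys_plus)

lemma disjoint_support_decomposition:
  assumes "support x \<subseteq> I \<union> J" "I \<inter> J = {}"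
  shows "x = indicator_vector (support x \<inter> I) + indicator_vector (support x \<inter> J)"
  using assms by (auto simp: eq_iff_keys_eq keys_plus)

lemma bij_betw_plus_supported_on:
  assumes "I \<inter> J = {}"
  shows "bij_betw (\<lambda>(u, v). u + v) (supported_on I \<times> supported_on J) (supported_on (I \<union> J))"
proof (rule bij_betw_byWitness [where f' = "\<lambda>x. (indicator_vector (support x \<inter> I), indicator_vector (support x \<inter> J))"])
  show "\<forall>a\<in>supported_on I \<times> supported_on J.
      (indicator_vector (support (case a of (u, v) \<Rightarrow> u + v) \<inter> I),
       indicator_vector (support (case a of (u, v) \<Rightarrow> u + v) \<inter> J)) = a"
    using assms by (auto simp: supported_on_def eq_iff_keys_eq keys_plus)
  show "\<forall>x\<in>supported_on (I \<union> J).
      (case (indicator_vector (support x \<inter> I), indicator_vector (support x \<inter> J)) of (u, v) \<Rightarrow> u + v) = x"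
    using disjoint_support_decomposition [OF _ assms] by (auto simp: supported_on_def)
qed (use assms in \<open>auto simp: supported_on_def keys_plus\<close>)

definition e0 :: F2_omega
  where "e0 = indicator_vector {0}"

lemma support_e0 [simp]: "support e0 = {0}"
  by (simp add: e0_def)

text \<open>
  Stage \<open>j\<close> takes care of the translation \<open>g j\<close> and of the number
  \<open>tol j\<close>, using a block of \<open>len j\<close> new coordinates. The coordinate
  \<open>0\<close> precedes all blocks, and \<open>g j\<close> uses only coordinates below block
  \<open>j\<close>.
\<close>
locale iterated_gluing =
  fixes len tol :: "nat \<Rightarrow> nat" and g :: "nat \<Rightarrow> F2_omega"
  assumes tol_less: "tol j < len j"
    and support_g: "support (g j) \<subseteq> {..<Suc (\<Sum>i<j. len i)}"
begin

definition start :: "nat \<Rightarrow> nat"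
  where "start j = Suc (\<Sum>i<j. len i)"

definition block :: "nat \<Rightarrow> nat set"
  where "block j = {start j..<start (Suc j)}"

definition weight :: "nat \<Rightarrow> F2_omega \<Rightarrow> nat"
  where "weight j x = card (support x \<inter> block j)"

definition low :: "nat \<Rightarrow> F2_omega set"
  where "low j = {x. 2 * weight j x + tol j < len j}"

definition high :: "nat \<Rightarrow> F2_omega set"
  where "high j = {x. len j + tol j < 2 * weight j x}"

text \<open>
  Each stage is a cylinder set; the shift by \<open>e0\<close> over the high points is what makes
  low and high points compatible, because \<open>e0\<close> is not a difference of any stage.
\<close>
fun glued :: "nat \<Rightarrow> F2_omega set"
  where
    "glued 0 = {x. 0 \<notin> support x}"
  | "glued (Suc j) = (low j \<inter> glued j) \<union> {x \<in> high j. x + g j + e0 \<in> glued j}"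

definition heavy :: "nat \<Rightarrow> F2_omega set"
  where "heavy j = {t \<in> supported_on (block j). len j - tol j \<le> card (support t)}"

definition cube :: "nat \<Rightarrow> F2_omega set"
  where "cube j = supported_on {..<start j}"

text \<open>
  A point of \<open>cube j\<close> vanishes on block \<open>j\<close> and all later ones, so it is
  low there and the later stages agree with stage \<open>j\<close> on it. The union below is
  therefore the pointwise limit of the stages on finitely supported vectors.
\<close>
definition limit_set :: "F2_omega set"
  where "limit_set = (\<Union>j. glued j \<inter> cube j)"

lemma start_Suc: "start (Suc j) = start j + len j"
  by (simp add: start_def)

lemma mono_start: "mono start"
  by (rule monoI) (simp add: start_def sum_mono2)

lemma start_ge: "Suc j \<le> start j"
proof (induction j)
  case (Suc j)
  then show ?case using tol_less [of j] by (simp add: start_Suc)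
qed (simp add: start_def)

lemma support_g_below_start: "support (g j) \<subseteq> {..<start j}"
  using support_g by (simp add: start_def)

lemma card_block [simp]: "card (block j) = len j" and finite_block [simp]: "finite (block j)"
  by (simp_all add: block_def start_Suc)

lemma start_pos: "0 < start j"
  by (simp add: start_def)

lemma zero_notin_block [simp]: "0 \<notin> block j"
  by (simp add: block_def start_def)

lemma weight_plus_disjoint: "support s \<inter> block j = {} \<Longrightarrow> weight j (x + s) = weight j x"
  unfolding weight_def by (rule arg_cong [of _ _ card]) (auto simp: keys_plus)

lemma low_high_plus_disjoint:
  assumes "support s \<inter> block j = {}"
  shows "x + s \<in> low j \<longleftrightarrow> x \<in> low j" "x + s \<in> high j \<longleftrightarrow> x \<in> high j"
  by (simp_all add: low_def high_def weight_plus_disjoint [OF assms])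

lemma glued_plus_above:
  "support v \<inter> {..<start j} = {} \<Longrightarrow> x + v \<in> glued j \<longleftrightarrow> x \<in> glued j"
proof (induction j arbitrary: x)
  case 0
  then have "0 \<notin> support v" by (auto simp: start_def)
  then show ?case by (simp add: keys_plus)
next
  case (Suc j)
  have *: "support v \<inter> block j = {}" "support v \<inter> {..<start j} = {}"
    using Suc.prems by (auto simp: block_def start_Suc)
  have "x + v + g j + e0 = (x + g j + e0) + v" by (simp add: algebra_simps)
  then have "x + v + g j + e0 \<in> glued j \<longleftrightarrow> x + g j + e0 \<in> glued j"
    by (simp only: Suc.IH [OF *(2)])
  then show ?case
    using Suc.IH [OF *(2)] by (simp add: low_high_plus_disjoint [OF *(1)])
qed

text \<open>
  Over a fixed point of the new block the next stage is empty or a translate of the old stage, so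
  differences that vanish on the new block remain forbidden.
\<close>
lemma glued_avoids_below:
  assumes "\<And>x. x \<in> glued j \<Longrightarrow> x + s \<notin> glued j" "support s \<inter> block j = {}" "x \<in> glued (Suc j)"
  shows "x + s \<notin> glued (Suc j)"
proof
  assume "x + s \<in> glued (Suc j)"
  with assms(3) have "(x \<in> low j \<and> x \<in> glued j) \<or> (x \<in> high j \<and> x + g j + e0 \<in> glued j)"
    and "(x \<in> low j \<and> x + s \<in> glued j) \<or> (x \<in> high j \<and> x + s + g j + e0 \<in> glued j)"
    by (auto simp: low_high_plus_disjoint [OF assms(2)])
  moreover have "\<not> (x \<in> low j \<and> x \<in> high j)" by (auto simp: low_def high_def)
  moreover have "x + s + g j + e0 = (x + g j + e0) + s" by (simp add: algebra_simps)
  ultimately show False using assms(1) by metis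
qed

lemma glued_avoids_e0: "x \<in> glued j \<Longrightarrow> x + e0 \<notin> glued j"
proof (induction j arbitrary: x)
  case 0
  then show ?case by (simp add: keys_plus)
next
  case (Suc j)
  show ?case
    by (rule glued_avoids_below [OF Suc.IH _ Suc.prems]) auto
qed

text \<open>
  Adding \<open>t\<close> complements the block up to at most \<open>tol j\<close> coordinates, so
  the two weights add up to nearly \<open>len j\<close>.
\<close>
lemma weight_plus_heavy:
  assumes "t \<in> heavy j"
  shows "len j \<le> weight j x + weight j (x + g j + t) + tol j"
    and "weight j x + weight j (x + g j + t) \<le> len j + tol j"
proof -
  let ?X = "support x \<inter> block j"
  have t: "support t \<subseteq> block j" "len j \<le> card (support t) + tol j"
    using assms by (auto simp: heavy_def supported_on_def)
  have "support (g j) \<inter> block j = {}" using support_g_below_start by (fastforce simp: block_def)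
  then have sup: "support (x + g j + t) \<inter> block j = (?X - support t) \<union> (support t - ?X)"
    using t(1) by (auto simp: keys_plus)
  then have w: "weight j (x + g j + t) = card (?X - support t) + card (support t - ?X)"
    unfolding weight_def by (subst sup) (rule card_Un_disjoint, auto)
  have "card ?X = card (?X \<inter> support t) + card (?X - support t)"
    using card_Int_Diff [of ?X "support t"] by simp
  moreover have "card (support t) = card (?X \<inter> support t) + card (support t - ?X)"
    using card_Int_Diff [of "support t" ?X] by (simp add: Int_commute)
  moreover have "card (?X - support t) \<le> tol j"
  proof -
    have "card (?X - support t) \<le> card (block j - support t)"
      by (intro card_mono) auto
    also have "\<dots> = len j - card (support t)"
      using t(1) by (simp add: card_Diff_subset)
    finally show ?thesis using t(2) by linarith
  qed
  moreover have "card (support t) \<le> len j"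
    using card_mono [OF finite_block t(1)] by simp
  moreover have "card (?X \<union> support t) \<le> len j"
    using card_mono [OF finite_block, of "?X \<union> support t" j] t(1) by simp
  moreover have "card (?X \<union> support t) = card (support t) + card (?X - support t)"
    by (subst card_Un_disjoint [symmetric]) (auto intro: arg_cong [of _ _ card])
  ultimately show "len j \<le> weight j x + weight j (x + g j + t) + tol j"
    and "weight j x + weight j (x + g j + t) \<le> len j + tol j"
    using t(2) w unfolding weight_def by linarith+
qed

text \<open>
  By the weights, one of two points with difference \<open>g j + t\<close> is low and the other
  high on block \<open>j\<close>. Below the block they would yield two points of the old stage with
  difference \<open>g j + (g j + e0) = e0\<close>. Differences that belong to an earlier
  block vanish on block \<open>j\<close>.
\<close>
lemma glued_avoids_heavy:
  assumes "i < J" "t \<in> heavy i"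
  shows "x \<in> glued J \<Longrightarrow> x + g i + t \<notin> glued J"
  using \<open>i < J\<close>
proof (induction J arbitrary: x)
  case (Suc j)
  show ?case
  proof (cases "i = j")
    case False
    then have "i < j" using Suc.prems by simp
    then have "start (Suc i) \<le> start j" "start i \<le> start j"
      by (auto intro: monoD [OF mono_start])
    then have "support (g i + t) \<inter> block j = {}"
      using support_g_below_start [of i] assms(2)
      by (fastforce simp: heavy_def supported_on_def block_def keys_plus)
    then show ?thesis
      using glued_avoids_below [of j "g i + t"] Suc \<open>i < j\<close> by (simp add: add.assoc)
  next
    case True
    let ?y = "x + g j + t"
    show ?thesis
    proof
      assume "x + g i + t \<in> glued (Suc j)"
      then have y: "(?y \<in> low j \<and> ?y \<in> glued j) \<or> (?y \<in> high j \<and> ?y + g j + e0 \<in> glued j)"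
        using True by auto
      have x: "(x \<in> low j \<and> x \<in> glued j) \<or> (x \<in> high j \<and> x + g j + e0 \<in> glued j)"
        using Suc.prems by auto
      have t: "support t \<inter> {..<start j} = {}"
        using assms(2) True by (auto simp: heavy_def supported_on_def block_def)
      have w: "len j \<le> weight j x + weight j ?y + tol j" "weight j x + weight j ?y \<le> len j + tol j"
        using weight_plus_heavy [of t j x] assms(2) True by auto
      then have "\<not> (x \<in> low j \<and> ?y \<in> low j)" "\<not> (x \<in> high j \<and> ?y \<in> high j)"
        by (auto simp: low_def high_def)
      then consider "x \<in> glued j" "?y + g j + e0 \<in> glued j"
        | "x + g j + e0 \<in> glued j" "?y \<in> glued j"
        using x y by blast
      then show False
      proof cases
        case 1
        have "?y + g j + e0 = x + e0 + t + (g j + g j)" by (simp only: ac_simps)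
        also have "\<dots> = x + e0 + t" by (simp only: add_self add_0_right)
        finally have "x + e0 \<in> glued j"
          using 1(2) by (simp only: glued_plus_above [OF t])
        then show False using glued_avoids_e0 [OF 1(1)] by simp
      next
        case 2
        then have "x + g j \<in> glued j" by (simp only: glued_plus_above [OF t])
        then show False using glued_avoids_e0 [of "x + g j"] 2(1) by simp
      qed
    qed
  qed
qed simp

lemma glued_stable:
  assumes "x \<in> cube i" "i \<le> j"
  shows "x \<in> glued j \<longleftrightarrow> x \<in> glued i"
  using \<open>i \<le> j\<close>
proof (induction j rule: dec_induct)
  case (step j)
  have "start i \<le> start j" using mono_start step.hyps by (auto dest: monoD)
  then have "support x \<inter> block j = {}"
    using assms(1) by (force simp: cube_def supported_on_def block_def)
  then have "weight j x = 0" by (simp add: weight_def)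
  then show ?case using step.IH tol_less [of j] by (simp add: low_def high_def)
qed simp

lemma limit_set_Int_cube: "limit_set \<inter> cube j = glued j \<inter> cube j"
proof -
  have "x \<in> glued j" if "x \<in> glued i" "x \<in> cube i" "x \<in> cube j" for x i
    using that glued_stable [of x i j] glued_stable [of x j i] by (cases "i \<le> j") auto
  then show ?thesis by (auto simp: limit_set_def)
qed

lemma difference_limit_set_avoids:
  assumes t: "t \<in> heavy i"
  shows "g i + t \<notin> difference_set limit_set"
proof
  assume "g i + t \<in> difference_set limit_set"
  then obtain x y where xy: "g i + t = x - y" "x \<in> limit_set" "y \<in> limit_set"
    by (auto simp: difference_set_def)
  then obtain a b where ab: "x \<in> glued a \<inter> cube a" "y \<in> glued b \<inter> cube b"
    by (auto simp: limit_set_def)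
  define J where "J = Suc (max i (max a b))"
  have "x \<in> glued J" "y \<in> glued J" "i < J"
    using ab glued_stable [of x a J] glued_stable [of y b J] by (auto simp: J_def)
  moreover have "x = y + g i + t"
    using xy(1) by (simp add: algebra_simps)
  ultimately show False using glued_avoids_heavy [OF _ t, of J y] by simp
qed

definition middle :: "nat \<Rightarrow> nat"
  where "middle j = (\<Sum>w\<in>middle_weights (len j) (tol j). len j choose w)"

lemma finite_cube [simp]: "finite (cube j)" and card_cube: "card (cube j) = 2 ^ start j"
  by (simp_all add: cube_def finite_supported_on card_supported_on)

lemma cube_Suc: "cube (Suc j) = supported_on ({..<start j} \<union> block j)"
  by (auto simp: cube_def block_def start_Suc intro!: arg_cong [of _ _ supported_on])

text \<open>
  Every low or high configuration of the new block carries a translate of the old stage; those of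
  middle weight carry nothing.
\<close>
lemma card_glued_Suc:
  "card (glued (Suc j) \<inter> cube (Suc j)) = card (glued j \<inter> cube j) * (2 ^ len j - middle j)"
proof -
  let ?V = "supported_on (block j)"
  let ?A = "glued j \<inter> cube j" and ?A' = "{x \<in> cube j. x + g j + e0 \<in> glued j}"
  let ?L = "?V \<inter> low j" and ?H = "?V \<inter> high j"
  let ?P = "\<lambda>p. (snd p \<in> low j \<and> fst p \<in> glued j) \<or> (snd p \<in> high j \<and> fst p + g j + e0 \<in> glued j)"
  have e0_g: "support (g j + e0) \<subseteq> {..<start j}"
    using support_plus_subset [of "g j" e0] support_g_below_start [of j] start_pos [of j] by fastforce
  have bij: "bij_betw (\<lambda>(u, v). u + v) (cube j \<times> ?V) (cube (Suc j))"
    unfolding cube_Suc cube_def [of j] by (rule bij_betw_plus_supported_on) (auto simp: block_def)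
  have mem: "u + v \<in> glued (Suc j) \<longleftrightarrow> ?P (u, v)" if "u \<in> cube j" "v \<in> ?V" for u v
  proof -
    have u: "support u \<inter> block j = {}" and v: "support v \<inter> {..<start j} = {}"
      using that by (force simp: cube_def supported_on_def block_def)+
    have "u + v + g j + e0 = (u + g j + e0) + v" by (simp only: ac_simps)
    then have "u + v + g j + e0 \<in> glued j \<longleftrightarrow> u + g j + e0 \<in> glued j"
      by (simp only: glued_plus_above [OF v])
    moreover have "u + v \<in> low j \<longleftrightarrow> v \<in> low j" "u + v \<in> high j \<longleftrightarrow> v \<in> high j"
      using low_high_plus_disjoint [OF u, of v] by (simp_all only: add.commute [of u v])
    ultimately show ?thesis
      by (simp add: glued_plus_above [OF v])
  qed
  have "bij_betw (\<lambda>(u, v). u + v) {p \<in> cube j \<times> ?V. ?P p} {x \<in> cube (Suc j). x \<in> glued (Suc j)}"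
  proof (rule bij_betw_Collect [OF bij])
    fix p assume "p \<in> cube j \<times> ?V"
    then have "fst p + snd p \<in> glued (Suc j) \<longleftrightarrow> ?P (fst p, snd p)"
      by (intro mem) auto
    then show "(case p of (u, v) \<Rightarrow> u + v) \<in> glued (Suc j) \<longleftrightarrow> ?P p"
      by (simp only: case_prod_beta prod.collapse)
  qed
  then have "card {x \<in> cube (Suc j). x \<in> glued (Suc j)} = card {p \<in> cube j \<times> ?V. ?P p}"
    by (rule bij_betw_same_card [symmetric])
  also have "{x \<in> cube (Suc j). x \<in> glued (Suc j)} = glued (Suc j) \<inter> cube (Suc j)" by blast
  also have "{p \<in> cube j \<times> ?V. ?P p} = ?A \<times> ?L \<union> ?A' \<times> ?H"
    by auto
  also have "card \<dots> = card ?A * card ?L + card ?A' * card ?H"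
  proof -
    have "?L \<inter> ?H = {}" by (auto simp: low_def high_def)
    then show ?thesis
      by (subst card_Un_disjoint) (auto simp: card_cartesian_product finite_supported_on)
  qed
  also have "card ?A' = card ?A"
  proof -
    \<comment> \<open>The shift preserves \<open>cube j\<close> and is its own inverse.\<close>
    have "bij_betw (\<lambda>x. x + (g j + e0)) ?A' ?A"
    proof (rule bij_betw_byWitness [where f' = "\<lambda>x. x + (g j + e0)"])
      have "x + (g j + e0) \<in> cube j" if "x \<in> cube j" for x
        using that e0_g by (auto simp: cube_def supported_on_def keys_plus)
      moreover have double: "x + (g j + e0) + (g j + e0) = x" for x
        by (simp only: add.assoc [of x] add_self add_0_right)
      ultimately show "(\<lambda>x. x + (g j + e0)) ` ?A' \<subseteq> ?A" "(\<lambda>x. x + (g j + e0)) ` ?A \<subseteq> ?A'"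
        by (auto simp: add.assoc)
      show "\<forall>x\<in>?A'. x + (g j + e0) + (g j + e0) = x" "\<forall>x\<in>?A. x + (g j + e0) + (g j + e0) = x"
        using double by auto
    qed
    then show ?thesis by (rule bij_betw_same_card)
  qed
  also have "card ?A * card ?L + card ?A * card ?H = card ?A * (2 ^ len j - middle j)"
  proof -
    let ?M = "{v \<in> ?V. card (support v) \<in> middle_weights (len j) (tol j)}"
    have w: "weight j v = card (support v)" if "v \<in> ?V" for v
      using that unfolding weight_def supported_on_def by (simp add: Int_absorb2)
    have "?V - ?M = ?L \<union> ?H"
      using w by (auto simp: low_def high_def middle_weights_def)
    moreover have "?L \<inter> ?H = {}" by (auto simp: low_def high_def)
    moreover have "card ?M = middle j"
    proof -
      have "(\<Sum>w\<in>middle_weights (len j) (tol j) \<inter> {..len j}. len j choose w) = middle j"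
        unfolding middle_def
        by (rule sum.mono_neutral_left) (auto simp: middle_weights_def intro: finite_subset [of _ "{..len j + tol j}"])
      then show ?thesis by (simp add: card_supported_on_weight)
    qed
    moreover have "card (?V - ?M) = card ?V - card ?M"
      by (rule card_Diff_subset) (auto simp: finite_supported_on)
    ultimately have "card ?L + card ?H = 2 ^ len j - middle j"
      by (simp add: card_supported_on card_Un_disjoint [symmetric] finite_supported_on)
    then show ?thesis by (simp add: distrib_left [symmetric])
  qed
  finally show ?thesis .
qed

definition cube_density :: "nat \<Rightarrow> real"
  where "cube_density j = real (card (limit_set \<inter> cube j)) / real (card (cube j))"

text \<open>
  Each stage multiplies the density by one minus the proportion of middle weights; as densities are
  at most one, it loses at most that proportion.
\<close>
lemma cube_density_ge: "1 / 2 - (\<Sum>i<j. real (middle i) / 2 ^ len i) \<le> cube_density j"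
proof (induction j)
  case 0
  have "x = 0" if "x \<in> glued 0 \<inter> cube 0" for x
  proof -
    have "support x \<subseteq> {0}" "0 \<notin> support x"
      using that by (auto simp: cube_def supported_on_def start_def)
    then have "support x = {}" by blast
    then show ?thesis by (simp only: eq_iff_keys_eq keys_zero)
  qed
  then have "glued 0 \<inter> cube 0 = {0}" by (auto simp: cube_def supported_on_def)
  then show ?case by (simp add: cube_density_def limit_set_Int_cube card_cube start_def del: glued.simps)
next
  case (Suc j)
  let ?q = "real (middle j) / 2 ^ len j"
  have "cube_density j \<le> 1"
    unfolding cube_density_def using card_mono [of "cube j" "limit_set \<inter> cube j"]
    by (auto simp: divide_le_eq_1)
  have "cube_density j - ?q \<le> cube_density j * (1 - ?q)"
    using mult_right_mono [OF \<open>cube_density j \<le> 1\<close>, of ?q] by (simp add: algebra_simps)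
  also have "\<dots> = real (card (glued j \<inter> cube j)) * (2 ^ len j - real (middle j)) / 2 ^ start (Suc j)"
    by (simp add: cube_density_def limit_set_Int_cube card_cube start_Suc power_add field_simps)
  also have "\<dots> \<le> real (card (glued j \<inter> cube j)) * real (2 ^ len j - middle j) / 2 ^ start (Suc j)"
    by (intro divide_right_mono mult_left_mono) (auto simp: of_nat_diff_if)
  also have "\<dots> = cube_density (Suc j)"
    by (simp add: cube_density_def limit_set_Int_cube card_cube card_glued_Suc del: glued.simps)
  finally show ?case using Suc.IH by simp
qed

lemma folner_sequence_cube: "folner_sequence cube"
  unfolding folner_sequence_def
proof (intro conjI allI)
  show "finite (cube n)" for n by simp
  have "0 \<in> cube n" for n by (simp add: cube_def supported_on_def)
  then show "cube n \<noteq> {}" for n by blast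
  fix h :: F2_omega
  obtain N where N: "support h \<subseteq> {..<N}"
    by (metis finite_keys finite_nat_iff_bounded)
  have "translate h (cube n) \<inter> cube n = cube n" if "n \<ge> N" for n
  proof -
    have h: "h \<in> cube n"
      using N that start_ge [of n] by (fastforce simp: cube_def supported_on_def)
    have "x \<in> translate h (cube n)" if "x \<in> cube n" for x
    proof -
      have "x = h + (h + x)" by (simp add: add.assoc [symmetric])
      moreover have "h + x \<in> cube n"
        using h that by (auto simp: cube_def supported_on_def keys_plus)
      ultimately show ?thesis unfolding translate_def by (rule image_eqI)
    qed
    then show ?thesis by blast
  qed
  then have "\<forall>\<^sub>F n in sequentially. real (card (translate h (cube n) \<inter> cube n)) / real (card (cube n)) = 1"
    by (intro eventually_sequentiallyI [of N]) (simp add: card_cube)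
  then show "(\<lambda>n. real (card (translate h (cube n) \<inter> cube n)) / real (card (cube n))) \<longlonglongrightarrow> 1"
    by (rule tendsto_eventually)
qed

lemma upper_banach_density_limit_set:
  assumes "\<And>j. (\<Sum>i<j. real (middle i) / 2 ^ len i) \<le> \<eta>"
  shows "ereal (1 / 2 - \<eta>) \<le> upper_banach_density limit_set"
  unfolding upper_banach_density_def
proof (rule SUP_upper2)
  show "cube \<in> {\<Phi>. folner_sequence \<Phi>}" using folner_sequence_cube by simp
  have "1 / 2 - \<eta> \<le> cube_density j" for j
    using cube_density_ge [of j] assms [of j] by linarith
  then show "ereal (1 / 2 - \<eta>) \<le> limsup (\<lambda>n. ereal (real (card (limit_set \<inter> cube n)) / real (card (cube n))))"
    by (intro le_Limsup always_eventually allI) (auto simp: cube_density_def)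
qed

end

section \<open>Differences of piecewise syndetic sets and Bohr sets\<close>

text \<open>
  Finitely many translates of a syndetic set \<open>B'\<close> cover the group; colour a vector by
  a translate that contains it. Vectors of the same colour differ by the difference of two elements
  of \<open>B'\<close>, and since \<open>B\<close> contains a translate of any two elements of
  \<open>B'\<close>, by an element of \<open>B - B\<close>. The number of colours depends only on
  \<open>B\<close>.
\<close>
lemma piecewise_syndetic_heavy_difference:
  assumes "piecewise_syndetic (B :: F2_omega set)"
  obtains r where "\<And>s n k. r \<le> k \<Longrightarrow> k \<le> n \<Longrightarrow> 0 < n \<Longrightarrow>
    \<exists>t \<in> supported_on {s..<s + n} \<inter> difference_set B. n - k \<le> card (support t)"
proof -
  obtain B' where B': "syndetic B'"
    and B: "\<forall>F. finite F \<and> F \<subseteq> B' \<longrightarrow> (\<exists>u. translate u F \<subseteq> B)"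
    using assms unfolding piecewise_syndetic_def by (elim exE conjE)
  obtain T where T: "finite T" "(\<Union>t\<in>T. translate t B') = UNIV"
    using B' unfolding syndetic_def by blast
  have "\<forall>x. \<exists>t. t \<in> T \<and> x \<in> translate t B'" using T(2) by blast
  from choice [OF this] obtain \<tau> where \<tau>: "\<And>x. \<tau> x \<in> T" "\<And>x. x \<in> translate (\<tau> x) B'"
    by blast
  obtain h where h: "bij_betw h T {0..<card T}" using ex_bij_betw_finite_nat [OF T(1)] by blast
  show thesis
  proof (rule that)
    fix s n k :: nat
    assume k: "card T \<le> k" "k \<le> n" "0 < n"
    define vec where "vec X = indicator_vector ((+) s ` X)" for X
    obtain X Y where XY: "X \<subseteq> {..<n}" "Y \<subseteq> {..<n}" "h (\<tau> (vec X)) = h (\<tau> (vec Y))"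
      "n - k \<le> card ((X - Y) \<union> (Y - X))"
    proof (rule near_antipodal_monochromatic_pair [of n "\<lambda>X. h (\<tau> (vec X))" "card T" k])
      show "h (\<tau> (vec X)) < card T" for X
        using bij_betwE [OF h] \<tau>(1) by auto
    qed (use k in auto)
    have "\<tau> (vec X) = \<tau> (vec Y)"
      by (rule inj_onD [OF bij_betw_imp_inj_on [OF h] XY(3) \<tau>(1) \<tau>(1)])
    then have "vec X \<in> translate (\<tau> (vec X)) B'" "vec Y \<in> translate (\<tau> (vec X)) B'"
      using \<tau>(2) [of "vec X"] \<tau>(2) [of "vec Y"] by simp_all
    then obtain t b b' where b: "b \<in> B'" "b' \<in> B'" "vec X = t + b" "vec Y = t + b'"
      unfolding translate_def by blast
    obtain u where "translate u {b, b'} \<subseteq> B" using B [rule_format, of "{b, b'}"] b by auto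
    then have "(u + b) - (u + b') \<in> difference_set B"
      unfolding translate_def difference_set_def by blast
    also have "(u + b) - (u + b') = vec X - vec Y" by (simp add: b)
    finally have diff: "vec X + vec Y \<in> difference_set B" by (simp only: diff_eq_add)
    have "finite X" "finite Y"
      using finite_subset [OF XY(1)] finite_subset [OF XY(2)] by simp_all
    then have supp: "support (vec X + vec Y) = (+) s ` ((X - Y) \<union> (Y - X))"
      unfolding vec_def by (auto simp: keys_plus)
    show "\<exists>t \<in> supported_on {s..<s + n} \<inter> difference_set B. n - k \<le> card (support t)"
    proof (intro bexI IntI)
      show "n - k \<le> card (support (vec X + vec Y))"
        unfolding supp using XY(4) by (simp add: card_image)
      show "vec X + vec Y \<in> supported_on {s..<s + n}"
        using XY(1,2) by (auto simp: supported_on_def supp)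
    qed (rule diff)
  qed
qed

lemma circle_character_F2:
  assumes "circle_character (\<psi> :: F2_omega \<Rightarrow> complex)"
  shows "\<psi> x = 1 \<or> \<psi> x = -1"
proof -
  have mult: "\<psi> (a + b) = \<psi> a * \<psi> b" and nz: "\<psi> a \<noteq> 0" for a b
    using assms by (auto simp: circle_character_def) (metis norm_zero zero_neq_one)
  have "\<psi> 0 = 1" using mult [of 0 0] nz [of 0] by simp
  then have "\<psi> x * \<psi> x = 1" using mult [of x x] by (simp only: add_self)
  then show ?thesis by (simp add: square_eq_1_iff)
qed

text \<open>
  The joint kernel of the characters is a subgroup, and its cosets are told apart by the finitely
  many sign patterns of the characters.
\<close>
lemma bohr_set_contains_difference_set:
  assumes "bohr_set (U :: F2_omega set)"
  obtains B where "piecewise_syndetic B" "difference_set B \<subseteq> U"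
proof -
  obtain \<epsilon> :: real and k :: nat and \<psi> :: "nat \<Rightarrow> F2_omega \<Rightarrow> complex"
    where \<epsilon>: "\<epsilon> > 0" and \<psi>: "\<And>j. j \<in> {1..k} \<Longrightarrow> circle_character (\<psi> j)"
      and U: "U = {g. \<forall>j\<in>{1..k}. norm (\<psi> j g - 1) < \<epsilon>}"
    using assms unfolding bohr_set_def by blast
  define B where "B = {x. \<forall>j\<in>{1..k}. \<psi> j x = 1}"
  define signs where "signs x = {j \<in> {1..k}. \<psi> j x = 1}" for x
  have plus: "x + y \<in> B" if "signs x = signs y" for x y
  proof -
    have "\<psi> j (x + y) = 1" if j: "j \<in> {1..k}" for j
    proof -
      have "\<psi> j x = 1 \<longleftrightarrow> \<psi> j y = 1"
        using \<open>signs x = signs y\<close> j by (auto simp: signs_def set_eq_iff)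
      then have "\<psi> j x * \<psi> j y = 1"
        using circle_character_F2 [OF \<psi> [OF j]] by (metis mult_1 mult_minus_left minus_minus)
      then show ?thesis using \<psi> [OF j] by (simp add: circle_character_def)
    qed
    then show ?thesis by (simp add: B_def)
  qed
  have "finite (range signs)"
    by (rule finite_subset [of _ "Pow {1..k}"]) (auto simp: signs_def)
  then obtain T where T: "finite T" "range signs = signs ` T"
    by (metis finite_subset_image subset_UNIV order_refl)
  have "syndetic B"
    unfolding syndetic_def
  proof (intro exI conjI)
    show "(\<Union>t\<in>T. translate t B) = UNIV"
    proof (intro equalityI subsetI UNIV_I)
      fix x :: F2_omega
      obtain t where t: "t \<in> T" "signs t = signs x" using T(2) by (metis imageE rangeI)
      have "x = t + (t + x)"
        by (simp only: add.assoc [symmetric] add_self add_0_left)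
      then have "x \<in> translate t B"
        unfolding translate_def using plus [OF t(2)] by (rule image_eqI)
      then show "x \<in> (\<Union>t\<in>T. translate t B)" using t(1) by blast
    qed
  qed (rule T(1))
  then have "piecewise_syndetic B"
    unfolding piecewise_syndetic_def
    by (intro exI [of _ B] conjI allI impI exI [of _ 0]) (auto simp: translate_def)
  moreover have "difference_set B \<subseteq> U"
  proof
    fix z assume "z \<in> difference_set B"
    then obtain x y where xy: "x \<in> B" "y \<in> B" "z = x + y"
      by (auto simp: difference_set_def diff_eq_add)
    then have "signs x = signs y" by (auto simp: signs_def B_def)
    then show "z \<in> U" using plus xy(3) \<epsilon> by (auto simp: U B_def)
  qed
  ultimately show thesis by (rule that)
qed

section \<open>A dense set whose differences contain no translated difference set\<close>

text \<open>
  All pairs of a finite support and a natural number are enumerated by \<open>prod_decode\<close>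
  and \<open>set_decode\<close>. The decoded support of stage \<open>j\<close> lies below
  \<open>j\<close>, hence below block \<open>j\<close>, as all blocks are nonempty.
\<close>

theorem theorem1p2:
  fixes c :: real
  assumes "c < 1 / 2"
  shows "\<exists>A :: F2_omega set.
    upper_banach_density A > ereal c \<and>
    \<not> (\<exists>(B :: F2_omega set) (g :: F2_omega).
        piecewise_syndetic B \<and> translate g (difference_set B) \<subseteq> difference_set A) \<and>
    \<not> (\<exists>(g :: F2_omega) (N :: F2_omega set).
        bohr_neighborhood g N \<and> N \<subseteq> difference_set A)"
proof -
  \<comment> \<open>Half of the available room is spent on the middle weights, so that the inequality stays strict.\<close>
  define \<eta> where "\<eta> = (1 / 2 - c) / 2"
  have \<eta>: "\<eta> > 0" "c < 1 / 2 - \<eta>" using assms by (simp_all add: \<eta>_def field_simps)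
  define tol where "tol j = snd (prod_decode j)" for j
  define h where "h j = indicator_vector (set_decode (fst (prod_decode j)))" for j
  have "\<exists>n. tol j < n \<and> real (\<Sum>w\<in>middle_weights n (tol j). n choose w) \<le> \<eta> / 2 ^ Suc j * 2 ^ n" for j
    using middle_weights_negligible [of "\<eta> / 2 ^ Suc j" "tol j"] \<eta>(1) by (metis divide_pos_pos zero_less_numeral zero_less_power)
  then obtain len where len: "\<And>j. tol j < len j"
    "\<And>j. real (\<Sum>w\<in>middle_weights (len j) (tol j). len j choose w) \<le> \<eta> / 2 ^ Suc j * 2 ^ len j"
    by metis
  interpret iterated_gluing len tol h
  proof
    show "tol j < len j" for j by (rule len)
    fix j
    have "i < Suc (\<Sum>i<j. len i)" if "i \<in> set_decode (fst (prod_decode j))" for i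
    proof -
      have "2 ^ i \<le> fst (prod_decode j)"
        using that by (intro leI notI) (simp add: set_decode_def)
      moreover have "i < 2 ^ i" by simp
      moreover have "fst (prod_decode j) \<le> j"
        by (metis le_prod_encode_1 prod.collapse prod_decode_inverse)
      moreover have "j \<le> (\<Sum>i<j. len i)"
      proof -
        have "(\<Sum>i<j. 1) \<le> (\<Sum>i<j. len i)"
          by (rule sum_mono) (metis One_nat_def Suc_leI le0 le_less_trans len(1))
        then show ?thesis by simp
      qed
      ultimately show ?thesis by linarith
    qed
    then show "support (h j) \<subseteq> {..<Suc (\<Sum>i<j. len i)}"
      by (auto simp: h_def)
  qed
  have "(\<Sum>i<j. real (middle i) / 2 ^ len i) \<le> \<eta>" for j
  proof -
    have "(\<Sum>i<j. real (middle i) / 2 ^ len i) \<le> (\<Sum>i<j. \<eta> / 2 ^ Suc i)"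
      using len(2) by (intro sum_mono) (simp add: middle_def pos_divide_le_eq)
    also have "\<dots> = \<eta> * (1 - (1 / 2) ^ j)"
      by (induction j) (auto simp: field_simps)
    also have "\<dots> \<le> \<eta>" using \<eta>(1) by (simp add: mult_le_cancel_left1)
    finally show ?thesis .
  qed
  then have "ereal (1 / 2 - \<eta>) \<le> upper_banach_density limit_set"
    by (rule upper_banach_density_limit_set)
  then have dense: "ereal c < upper_banach_density limit_set"
    using \<eta>(2) by (metis ereal_less(2) less_ereal.simps(1) less_le_trans)
  have no_translate: False
    if B: "piecewise_syndetic B" "translate x (difference_set B) \<subseteq> difference_set limit_set"
    for B :: "F2_omega set" and x
  proof -
    obtain r where r: "\<And>s n k. r \<le> k \<Longrightarrow> k \<le> n \<Longrightarrow> 0 < n \<Longrightarrow>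
        \<exists>t \<in> supported_on {s..<s + n} \<inter> difference_set B. n - k \<le> card (support t)"
      using piecewise_syndetic_heavy_difference [OF B(1)] by blast
    define j where "j = prod_encode (set_encode (support x), r)"
    have "tol j = r" "h j = x"
      by (simp_all add: tol_def h_def j_def)
    then obtain t where "t \<in> heavy j" "t \<in> difference_set B"
      using r [of "tol j" "len j" "start j"] tol_less [of j]
      by (auto simp: heavy_def block_def start_Suc)
    then have "h j + t \<in> difference_set limit_set"
      using B(2) \<open>h j = x\<close> by (auto simp: translate_def)
    then show False using difference_limit_set_avoids [OF \<open>t \<in> heavy j\<close>] by blast
  qed
  moreover have False if N: "bohr_neighborhood x N" "N \<subseteq> difference_set limit_set" for x N
  proof -
    obtain U where "bohr_set U" "translate x U \<subseteq> N"
      using N(1) unfolding bohr_neighborhood_def by blast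
    moreover from this obtain B where "piecewise_syndetic B" "difference_set B \<subseteq> U"
      using bohr_set_contains_difference_set by blast
    ultimately show False
      using no_translate [of B x] N(2) by (force simp: translate_def)
  qed
  ultimately show ?thesis using dense by blast
qed

end
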